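(* Let $H$ be a 3-uniform marked hyperforest with no edge all of whose vertices are marked. Then $H$ is a Maker win if and only if $H$ contains a nunchaku. Moreover, if $H$ is a Maker win, then $\tau_M(H)=1+\lceil\log_2(L(H))\rceil$, where $L(H)$ is the length of a shortest nunchaku in $H$.
   Context: A marked hypergraph $H$: finite nonempty $V(H)$, edge set $E(H)$ of nonempty subsets of $V(H)$, marked set $M(H)\subseteq V(H)$; 3-uniform: all edges of size 3. Subhypergraph $X$: $V(X)\subseteq V(H)$, $E(X)\subseteq E(H)$, $M(X)=V(X)\cap M(H)$; "contains" means as a subhypergraph. $H^{+x}$ marks non-marked $x$; $H^{-y}$ deletes $y$ and all edges containing it; composed left to right. Trivial Maker win: some edge $e$ with $|e\setminus M(H)|\le1$. Maker win (recursive): if $|V(H)\setminus M(H)|\le1$, iff trivial Maker win; otherwise iff some non-marked $x$ has $H^{+x-y}$ a Maker win for all non-marked $y\ne x$; otherwise Breaker win. $\tau_M(H)$: if trivial Maker win, $\min_{e}|e\setminus M(H)|$; if not trivial Maker win and $|V(H)\setminus M(H)|\le1$, $\infty$; otherwise $1+\min_{x}\max_{y}\tau_M(H^{+x-y})$ over non-marked $x$ and non-marked $y\ne x$. $ab$-path of length $L\ge1$: edges $e_1,\dots,e_L$ (3-sets), vertex set $\bigcup e_i$, $|e_i\cap e_{i+1}|=1$, $e_i\cap e_j=\varnothing$ for $|i-j|\ge2$, $a\ne b$, $a\in e_1\setminus\bigcup_{i\ge2}e_i$, $b\in e_L\setminus\bigcup_{i<L}e_i$. A nunchaku is an $ab$-path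 of positive length whose marked vertices are exactly $a$ and $b$. An $a$-cycle of length $L\ge2$: edges $e_1,\dots,e_L$, vertex set $\bigcup e_i$, $a\in e_1\cap e_L$, $a\notin e_i$ for $1<i<L$; if $L=2$, $|e_1\cap e_2|=2$; if $L\ge3$, $|e_i\cap e_{i+1}|=1$, $e_1\cap e_L=\{a\}$, other pairs with $|i-j|\ge2$ disjoint. A 3-uniform marked hyperforest is a 3-uniform marked hypergraph containing no cycle. *)

theory Defs
  imports Complex_Main "HOL-Library.Extended_Nat"
begin

record 'a mhypergraph =
  verts :: "'a set"
  edges :: "'a set set"
  marked :: "'a set"

definition marked_hypergraph :: "'a mhypergraph \<Rightarrow> bool" where
  "marked_hypergraph H \<longleftrightarrow>
     finite (verts H) \<and> verts H \<noteq> {} \<and>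
     (\<forall>e\<in>edges H. e \<noteq> {} \<and> e \<subseteq> verts H) \<and>
     marked H \<subseteq> verts H"

definition three_uniform :: "'a mhypergraph \<Rightarrow> bool" where
  "three_uniform H \<longleftrightarrow> (\<forall>e\<in>edges H. card e = 3)"

definition subhypergraph :: "'a mhypergraph \<Rightarrow> 'a mhypergraph \<Rightarrow> bool" where
  "subhypergraph X H \<longleftrightarrow>
     marked_hypergraph X \<and> verts X \<subseteq> verts H \<and> edges X \<subseteq> edges H \<and>
     marked X = verts X \<inter> marked H"

definition unmarked :: "'a mhypergraph \<Rightarrow> 'a set" where
  "unmarked H = verts H - marked H"

definition mark_vertex :: "'a mhypergraph \<Rightarrow> 'a \<Rightarrow> 'a mhypergraph" where
  "mark_vertex H x = H\<lparr>marked := insert x (marked H)\<rparr>"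

definition delete_vertex :: "'a mhypergraph \<Rightarrow> 'a \<Rightarrow> 'a mhypergraph" where
  "delete_vertex H y =
     \<lparr>verts = verts H - {y}, edges = {e \<in> edges H. y \<notin> e}, marked = marked H - {y}\<rparr>"

definition trivial_maker_win :: "'a mhypergraph \<Rightarrow> bool" where
  "trivial_maker_win H \<longleftrightarrow> (\<exists>e\<in>edges H. card (e - marked H) \<le> 1)"

lemma card_unmarked_round_less:
  assumes "\<not> card (unmarked H) \<le> 1" "x \<in> unmarked H"
  shows "card (unmarked (delete_vertex (mark_vertex H x) y)) < card (unmarked H)"
proof (rule psubset_card_mono)
  show "finite (unmarked H)"
    using assms(1) card.infinite by fastforce
  show "unmarked (delete_vertex (mark_vertex H x) y) \<subset> unmarked H"
    using assms(2) by (auto simp: unmarked_def delete_vertex_def mark_vertex_def)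
qed

function maker_win :: "'a mhypergraph \<Rightarrow> bool" where
  "maker_win H \<longleftrightarrow>
     (if card (unmarked H) \<le> 1 then trivial_maker_win H
      else \<exists>x\<in>unmarked H. \<forall>y\<in>unmarked H - {x}.
             maker_win (delete_vertex (mark_vertex H x) y))"
  by pat_completeness auto
termination
  by (relation "measure (\<lambda>H. card (unmarked H))")
     (auto simp: card_unmarked_round_less simp del: One_nat_def)

declare maker_win.simps [simp del]

function tau_M :: "'a mhypergraph \<Rightarrow> enat" where
  "tau_M H =
     (if trivial_maker_win H then enat (MIN e\<in>edges H. card (e - marked H))
      else if card (unmarked H) \<le> 1 then \<infinity>
      else 1 + (MIN x\<in>unmarked H. MAX y\<in>unmarked H - {x}.
                  tau_M (delete_vertex (mark_vertex H x) y)))"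
  by pat_completeness auto
termination
  by (relation "measure (\<lambda>H. card (unmarked H))")
     (auto simp: card_unmarked_round_less simp del: One_nat_def)

declare tau_M.simps [simp del]

text \<open>
  Paths and cycles are given by the list of their edges, indexed from 0. Their marked sets
  are left unconstrained.
\<close>

definition path_of :: "'a \<Rightarrow> 'a \<Rightarrow> 'a set list \<Rightarrow> 'a mhypergraph \<Rightarrow> bool" where
  "path_of a b es X \<longleftrightarrow>
     verts X = \<Union> (set es) \<and> edges X = set es \<and>
     length es \<ge> 1 \<and> (\<forall>e\<in>set es. card e = 3) \<and>
     (\<forall>i. i + 1 < length es \<longrightarrow> card (es ! i \<inter> es ! (i + 1)) = 1) \<and>
     (\<forall>i j. i + 2 \<le> j \<and> j < length es \<longrightarrow> es ! i \<inter> es ! j = {}) \<and>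
     a \<noteq> b \<and>
     a \<in> es ! 0 - (\<Union>i\<in>{1..<length es}. es ! i) \<and>
     b \<in> es ! (length es - 1) - (\<Union>i\<in>{..<length es - 1}. es ! i)"

definition is_nunchaku :: "'a mhypergraph \<Rightarrow> nat \<Rightarrow> bool" where
  "is_nunchaku X L \<longleftrightarrow>
     marked_hypergraph X \<and> (\<exists>a b es. path_of a b es X \<and> length es = L \<and> marked X = {a, b})"

definition contains_nunchaku :: "'a mhypergraph \<Rightarrow> bool" where
  "contains_nunchaku H \<longleftrightarrow> (\<exists>X L. subhypergraph X H \<and> is_nunchaku X L)"

definition shortest_nunchaku_length :: "'a mhypergraph \<Rightarrow> nat" where
  "shortest_nunchaku_length H = (LEAST L. \<exists>X. subhypergraph X H \<and> is_nunchaku X L)"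

definition cycle_of :: "'a \<Rightarrow> 'a set list \<Rightarrow> 'a mhypergraph \<Rightarrow> bool" where
  "cycle_of a es X \<longleftrightarrow>
     verts X = \<Union> (set es) \<and> edges X = set es \<and>
     length es \<ge> 2 \<and> (\<forall>e\<in>set es. card e = 3) \<and>
     a \<in> es ! 0 \<inter> es ! (length es - 1) \<and>
     (\<forall>i. 0 < i \<and> i < length es - 1 \<longrightarrow> a \<notin> es ! i) \<and>
     (length es = 2 \<longrightarrow> card (es ! 0 \<inter> es ! 1) = 2) \<and>
     (length es \<ge> 3 \<longrightarrow>
        (\<forall>i. i + 1 < length es \<longrightarrow> card (es ! i \<inter> es ! (i + 1)) = 1) \<and>
        es ! 0 \<inter> es ! (length es - 1) = {a} \<and>
        (\<forall>i j. i + 2 \<le> j \<and> j < length es \<and> (i, j) \<noteq> (0, length es - 1) \<longrightarrow>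
           es ! i \<inter> es ! j = {}))"

definition hyperforest3 :: "'a mhypergraph \<Rightarrow> bool" where
  "hyperforest3 H \<longleftrightarrow>
     marked_hypergraph H \<and> three_uniform H \<and>
     \<not> (\<exists>X a es. subhypergraph X H \<and> cycle_of a es X)"

end

theory Submission imports Defs begin

text \<open>
  Maker bisects: marking a middle joint of a nunchaku of length \<open>L \<le> 2 ^ (k + 1)\<close> leaves two
  nunchakus of length at most \<open>2 ^ k\<close> that share only that joint, and Breaker can destroy only one
  of them. Conversely, suppose every nunchaku is longer than \<open>2 ^ k\<close> and Maker marks \<open>x\<close>.
  Every new nunchaku of length at most \<open>2 ^ k / 2\<close> starts at \<open>x\<close>. If two of these had different
  first edges, they would meet only in \<open>x\<close> (otherwise there is a cycle), and their union would have
  been a nunchaku of length at most \<open>2 ^ k\<close> before the move. So they all share their first edge,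
  and Breaker deletes an unmarked vertex of it.
\<close>

section \<open>Linked lists of edges\<close>

text \<open>The intersection pattern that \<open>path_of\<close> demands, without its endpoints. The
  recursive form suits induction, concatenation and reversal, and it also describes a cycle that has
  been opened at one end.\<close>

fun linked :: "'a set list \<Rightarrow> bool" where
  "linked [] = True"
| "linked [e] = True"
| "linked (e # f # es) = (card (e \<inter> f) = 1 \<and> (\<forall>g\<in>set es. e \<inter> g = {}) \<and> linked (f # es))"

lemma linked_Cons:
  "linked (e # es) \<longleftrightarrow>
     (es \<noteq> [] \<longrightarrow> card (e \<inter> hd es) = 1) \<and> (\<forall>g\<in>set (tl es). e \<inter> g = {}) \<and> linked es"
  by (cases es) auto

text \<open>Apart from the junction of \<open>last xs\<close> and \<open>hd ys\<close>, a cross pair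
  misses the last position of \<open>xs\<close> or the first position of \<open>ys\<close>. The two
  disjointness clauses cover these two cases.\<close>

lemma linked_append:
  "linked (xs @ ys) \<longleftrightarrow> linked xs \<and> linked ys \<and>
     (xs \<noteq> [] \<longrightarrow> ys \<noteq> [] \<longrightarrow> card (last xs \<inter> hd ys) = 1) \<and>
     (\<forall>e\<in>set (butlast xs). \<forall>f\<in>set ys. e \<inter> f = {}) \<and>
     (\<forall>e\<in>set xs. \<forall>f\<in>set (tl ys). e \<inter> f = {})"
proof (induction xs)
  case (Cons x xs)
  show ?case
  proof (cases xs)
    case Nil
    then show ?thesis by (auto simp: linked_Cons)
  next
    case (Cons z zs)
    show ?thesis
      using Cons.IH unfolding Cons by (cases ys) auto
  qed
qed auto

lemma linked_rev [simp]: "linked (rev es) = linked es"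
proof (induction es)
  case (Cons e es)
  then show ?case
    by (cases es rule: rev_cases)
       (auto simp: linked_append linked_Cons last_rev Int_commute hd_append split: if_splits)
qed simp

text \<open>Bridge to the indexed conditions in \<open>path_of\<close> and
  \<open>cycle_of\<close>.\<close>

lemma linked_iff_nth:
  "linked es \<longleftrightarrow> (\<forall>i. i + 1 < length es \<longrightarrow> card (es ! i \<inter> es ! (i + 1)) = 1) \<and>
     (\<forall>i j. i + 2 \<le> j \<and> j < length es \<longrightarrow> es ! i \<inter> es ! j = {})" (is "_ \<longleftrightarrow> ?C es \<and> ?D es")
proof (induction es)
  case (Cons e es)
  have C: "?C (e # es) \<longleftrightarrow> (es \<noteq> [] \<longrightarrow> card (e \<inter> hd es) = 1) \<and> ?C es"
  proof (intro iffI conjI allI impI)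
    assume C: "?C (e # es)" and "es \<noteq> []"
    then show "card (e \<inter> hd es) = 1" using C[rule_format, of 0] by (simp add: hd_conv_nth)
  next
    fix i assume C: "?C (e # es)" and "i + 1 < length es"
    then show "card (es ! i \<inter> es ! (i + 1)) = 1" using C[rule_format, of "Suc i"] by simp
  next
    fix i assume "(es \<noteq> [] \<longrightarrow> card (e \<inter> hd es) = 1) \<and> ?C es" "i + 1 < length (e # es)"
    then show "card ((e # es) ! i \<inter> (e # es) ! (i + 1)) = 1"
      by (cases i; cases es) auto
  qed
  have D: "?D (e # es) \<longleftrightarrow> (\<forall>g\<in>set (tl es). e \<inter> g = {}) \<and> ?D es" (is "_ = (?T \<and> _)")
  proof (intro iffI conjI allI impI ballI)
    fix g assume D: "?D (e # es)" and "g \<in> set (tl es)"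
    then obtain k where "k < length es - 1" "g = es ! Suc k"
      by (auto simp: in_set_conv_nth nth_tl)
    then show "e \<inter> g = {}" using D[rule_format, of 0 "Suc (Suc k)"] by simp
  next
    fix i j assume D: "?D (e # es)" and "i + 2 \<le> j \<and> j < length es"
    then show "es ! i \<inter> es ! j = {}" using D[rule_format, of "Suc i" "Suc j"] by simp
  next
    fix i j assume TD: "?T \<and> ?D es" and ij: "i + 2 \<le> j \<and> j < length (e # es)"
    define j' where "j' = j - 2"
    have j: "j = Suc (Suc j')" using ij unfolding j'_def by linarith
    show "(e # es) ! i \<inter> (e # es) ! j = {}"
    proof (cases i)
      case 0
      have "tl es ! j' \<in> set (tl es)" using ij j by (intro nth_mem) auto
      then show ?thesis using TD 0 ij j by (simp add: nth_tl)
    next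
      case (Suc i')
      then show ?thesis using TD ij j by auto
    qed
  qed
  show ?case unfolding C D unfolding linked_Cons Cons.IH by (simp only: conj_ac)
qed simp

section \<open>Paths with one or two controlled ends\<close>

definition rooted :: "'a \<Rightarrow> 'a set list \<Rightarrow> bool" where
  "rooted a es \<longleftrightarrow> es \<noteq> [] \<and> (\<forall>e\<in>set es. card e = 3) \<and> linked es \<and> a \<in> hd es \<and>
     a \<notin> \<Union> (set (tl es))"

definition edge_path :: "'a \<Rightarrow> 'a \<Rightarrow> 'a set list \<Rightarrow> bool" where
  "edge_path a b es \<longleftrightarrow> a \<noteq> b \<and> rooted a es \<and> rooted b (rev es)"

lemma edge_path_rev: "edge_path a b es \<Longrightarrow> edge_path b a (rev es)"
  by (auto simp: edge_path_def)

lemma set_tl_conv_nth: "set (tl es) = (!) es ` {1..<length es}"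
proof -
  have "set (tl es) = (!) (tl es) ` {0..<length (tl es)}" by (simp add: nth_image)
  also have "\<dots> = (\<lambda>i. es ! Suc i) ` {0..<length es - 1}" by (intro image_cong) (auto simp: nth_tl)
  also have "\<dots> = (!) es ` Suc ` {0..<length es - 1}" by (simp only: image_image)
  also have "Suc ` {0..<length es - 1} = {1..<length es}"
    by (cases es) (simp_all add: image_Suc_atLeastLessThan)
  finally show ?thesis .
qed

lemma set_butlast_conv_nth: "set (butlast es) = (!) es ` {..<length es - 1}"
  by (simp add: butlast_conv_take nth_image flip: atLeast0LessThan)

lemma tl_rev: "tl (rev es) = rev (butlast es)"
  by (metis butlast_rev rev_rev_ident)

lemma path_of_iff:
  "path_of a b es X \<longleftrightarrow> verts X = \<Union> (set es) \<and> edges X = set es \<and> edge_path a b es"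
proof (cases "es = []")
  case True
  then show ?thesis by (simp add: path_of_def edge_path_def rooted_def)
next
  case False
  then have "length es \<ge> 1" by (cases es) auto
  with False show ?thesis
    unfolding path_of_def edge_path_def rooted_def
    by (simp add: linked_iff_nth[of es] hd_rev tl_rev set_tl_conv_nth set_butlast_conv_nth
        last_conv_nth hd_conv_nth conj_ac)
qed

text \<open>A nunchaku is kept as its edge list inside \<open>H\<close>; the subhypergraph it spans
  can be recovered from the list.\<close>

definition nunchaku_in :: "'a mhypergraph \<Rightarrow> 'a \<Rightarrow> 'a \<Rightarrow> 'a set list \<Rightarrow> bool" where
  "nunchaku_in H a b es \<longleftrightarrow>
     edge_path a b es \<and> set es \<subseteq> edges H \<and> \<Union> (set es) \<inter> marked H = {a, b}"

lemma ex_nunchaku_iff: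
  assumes "marked_hypergraph H"
  shows "(\<exists>X. subhypergraph X H \<and> is_nunchaku X L) \<longleftrightarrow>
    (\<exists>a b es. nunchaku_in H a b es \<and> length es = L)"
proof safe
  fix X assume X: "subhypergraph X H" "is_nunchaku X L"
  then show "\<exists>a b es. nunchaku_in H a b es \<and> length es = L"
    unfolding subhypergraph_def is_nunchaku_def nunchaku_in_def path_of_iff
    by (elim conjE exE) (metis (no_types))
next
  fix a b es assume n: "nunchaku_in H a b es" "L = length es"
  let ?X = "\<lparr>verts = \<Union> (set es), edges = set es, marked = {a, b}\<rparr>"
  have "marked_hypergraph ?X"
  proof -
    have "\<Union> (set es) \<subseteq> verts H" "finite (verts H)"
      using assms n(1) by (auto simp: nunchaku_in_def marked_hypergraph_def)
    then have "finite (\<Union> (set es))" by (rule finite_subset)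
    moreover have "\<And>e. e \<in> set es \<Longrightarrow> e \<noteq> {}"
      using n(1) by (force simp: nunchaku_in_def edge_path_def rooted_def)
    moreover have "{a, b} \<subseteq> \<Union> (set es)" using n(1) by (auto simp: nunchaku_in_def)
    ultimately show ?thesis by (auto simp: marked_hypergraph_def)
  qed
  moreover have "verts ?X \<subseteq> verts H"
    using assms n by (auto simp: nunchaku_in_def marked_hypergraph_def)
  ultimately have "subhypergraph ?X H" "is_nunchaku ?X (length es)"
    using n by (auto simp: subhypergraph_def is_nunchaku_def nunchaku_in_def path_of_iff)
  then show "\<exists>X. subhypergraph X H \<and> is_nunchaku X (length es)" by blast
qed

section \<open>Acyclic edge sets and diverging branches\<close>

text \<open>Since \<open>cycle_of\<close> ignores marks, the empty marked set is only a placeholder.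
  Absence of cycles thus becomes a property of the edge set alone, inherited by subsets and hence
  preserved by a round of the game.\<close>

definition acyclic_edges :: "'a set set \<Rightarrow> bool" where
  "acyclic_edges E \<longleftrightarrow> \<not> (\<exists>a es. set es \<subseteq> E \<and>
     cycle_of a es \<lparr>verts = \<Union> (set es), edges = set es, marked = {}\<rparr>)"

lemma acyclic_edges_mono: "acyclic_edges E \<Longrightarrow> F \<subseteq> E \<Longrightarrow> acyclic_edges F"
  by (meson acyclic_edges_def order_trans)

lemma hyperforest3_acyclic_edges:
  assumes "hyperforest3 H"
  shows "acyclic_edges (edges H)"
proof (rule ccontr)
  assume "\<not> acyclic_edges (edges H)"
  then obtain a es where es: "set es \<subseteq> edges H"
    and c: "cycle_of a es \<lparr>verts = \<Union> (set es), edges = set es, marked = {}\<rparr>"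
    by (auto simp: acyclic_edges_def)
  let ?X = "\<lparr>verts = \<Union> (set es), edges = set es, marked = \<Union> (set es) \<inter> marked H\<rparr>"
  have H: "marked_hypergraph H" using assms by (simp add: hyperforest3_def)
  \<comment> \<open>This makes the vertex set of \<open>?X\<close> nonempty, as
    \<open>marked_hypergraph\<close> requires.\<close>
  have "a \<in> \<Union> (set es)"
    using c by (intro UnionI[of "es ! 0"] nth_mem) (auto simp: cycle_of_def)
  moreover have "\<Union> (set es) \<subseteq> verts H" using es H by (auto simp: marked_hypergraph_def)
  ultimately have "subhypergraph ?X H"
    using es H by (auto simp: subhypergraph_def marked_hypergraph_def intro: finite_subset)
  moreover have "cycle_of a es ?X" using c by (simp add: cycle_of_def)
  ultimately show False using assms unfolding hyperforest3_def by blast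
qed

text \<open>Two edges sharing exactly two vertices form a cycle of length 2, and two edges of size 3
  sharing three vertices are equal.\<close>

lemma acyclic_edges_card_Int:
  assumes "acyclic_edges E" "e \<in> E" "f \<in> E" "card e = 3" "card f = 3" "e \<noteq> f"
  shows "card (e \<inter> f) \<le> 1"
proof (rule ccontr)
  assume "\<not> card (e \<inter> f) \<le> 1"
  moreover have fin: "finite e" "finite f" using assms by (auto intro: card_ge_0_finite)
  have "card (e \<inter> f) < 3"
  proof (rule ccontr)
    assume "\<not> card (e \<inter> f) < 3"
    then have "card e \<le> card (e \<inter> f)" "card f \<le> card (e \<inter> f)" using assms by auto
    then have "e \<inter> f = e" "e \<inter> f = f" using fin by (metis Int_lower1 Int_lower2 card_seteq)+
    then show False using assms by simp
  qed
  ultimately have 2: "card (e \<inter> f) = 2" by linarith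
  then obtain a where "a \<in> e \<inter> f" by (metis card.empty ex_in_conv zero_neq_numeral)
  with 2 assms(4,5) have "cycle_of a [e, f] \<lparr>verts = \<Union> (set [e, f]), edges = set [e, f], marked = {}\<rparr>"
    by (auto simp: cycle_of_def)
  with assms(1-3) show False unfolding acyclic_edges_def by (metis empty_set empty_subsetI insert_subset list.simps(15))
qed

text \<open>Every pair of positions except the first with the last lies within
  \<open>butlast es\<close> or within \<open>tl es\<close>. Linkedness of these two lists therefore
  gives all intersection conditions of a cycle but the closing one.\<close>

lemma cycle_ofI:
  assumes n: "length es \<ge> 3" and "\<forall>e\<in>set es. card e = 3"
    and l1: "linked (butlast es)" and l2: "linked (tl es)" and a: "hd es \<inter> last es = {a}"
    and "a \<notin> \<Union> (set (butlast (tl es)))"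
  shows "cycle_of a es \<lparr>verts = \<Union> (set es), edges = set es, marked = {}\<rparr>"
proof -
  have "es \<noteq> []" using n by auto
  have hl: "es ! 0 \<inter> es ! (length es - 1) = {a}"
    using a \<open>es \<noteq> []\<close> by (simp add: hd_conv_nth last_conv_nth)
  have "a \<notin> es ! i" if "0 < i" "i < length es - 1" for i
  proof -
    have "butlast (tl es) ! (i - 1) = es ! i" using that by (simp add: nth_butlast nth_tl)
    moreover have "butlast (tl es) ! (i - 1) \<in> set (butlast (tl es))"
      using that by (intro nth_mem) auto
    ultimately show ?thesis using assms(6) by auto
  qed
  moreover have "card (es ! i \<inter> es ! (i + 1)) = 1" if i: "i + 1 < length es" for i
  proof (cases "i + 1 < length es - 1")
    case True
    with l1 show ?thesis by (simp add: linked_iff_nth nth_butlast)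
  next
    case False
    with i n obtain k where "i = Suc k" by (cases i) auto
    with l2 i show ?thesis unfolding linked_iff_nth by (auto simp: nth_tl dest!: spec[of _ k])
  qed
  moreover have "es ! i \<inter> es ! j = {}"
    if ij: "i + 2 \<le> j" "j < length es" "(i, j) \<noteq> (0, length es - 1)" for i j
  proof (cases "j < length es - 1")
    case True
    with l1 ij show ?thesis by (simp add: linked_iff_nth nth_butlast)
  next
    case False
    with ij obtain k m where "i = Suc k" "j = Suc m" by (cases i; cases j) auto
    with l2 ij show ?thesis
      unfolding linked_iff_nth by (auto simp: nth_tl dest!: spec[of _ k] spec[of _ m])
  qed
  ultimately show ?thesis using n assms(2) hl by (auto simp: cycle_of_def)
qed

lemma rooted_butlast: "rooted x es \<Longrightarrow> butlast es \<noteq> [] \<Longrightarrow> rooted x (butlast es)"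
  by (cases es rule: rev_cases)
     (auto simp: rooted_def linked_append hd_append tl_append split: list.splits)

text \<open>Without cycles, two branches that leave \<open>x\<close> by different edges never meet
  again. The induction is on the total length, dropping the last edge of one branch at a
  time.\<close>

lemma rooted_diverge:
  assumes "rooted x es" "rooted x fs" "hd es \<noteq> hd fs" "acyclic_edges (set es \<union> set fs)"
  shows "\<Union> (set es) \<inter> \<Union> (set fs) = {x}"
  using assms
proof (induction "length es + length fs" arbitrary: es fs rule: less_induct)
  case less
  note es = less.prems(1) and fs = less.prems(2) and ne = less.prems(3) and ac = less.prems(4)
  have es0: "es \<noteq> []" "fs \<noteq> []" using es fs by (auto simp: rooted_def)
  have x: "x \<in> hd es" "x \<in> hd fs" "\<And>e. e \<in> set (tl es) \<Longrightarrow> x \<notin> e" "\<And>e. e \<in> set (tl fs) \<Longrightarrow> x \<notin> e"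
    using es fs by (auto simp: rooted_def)
  have c3: "\<And>e. e \<in> set es \<union> set fs \<Longrightarrow> card e = 3" using es fs by (auto simp: rooted_def)
  have hd_but: "hd (butlast gs) = hd gs" if "butlast gs \<noteq> []" for gs :: "'a set list"
    using that by (cases gs) auto
  have A: "e \<inter> f \<subseteq> {x}" if "e \<in> set (butlast es)" "f \<in> set fs" for e f
  proof -
    have b: "butlast es \<noteq> []" using that by auto
    have "\<Union> (set (butlast es)) \<inter> \<Union> (set fs) = {x}"
      using es fs ne es0 b acyclic_edges_mono[OF ac, of "set (butlast es) \<union> set fs"]
      by (intro less.hyps rooted_butlast) (auto simp: hd_but dest: in_set_butlastD)
    with that show ?thesis by blast
  qed
  have B: "e \<inter> f \<subseteq> {x}" if "e \<in> set es" "f \<in> set (butlast fs)" for e f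
  proof -
    have b: "butlast fs \<noteq> []" using that by auto
    have "\<Union> (set es) \<inter> \<Union> (set (butlast fs)) = {x}"
      using es fs ne es0 b acyclic_edges_mono[OF ac, of "set es \<union> set (butlast fs)"]
      by (intro less.hyps rooted_butlast) (auto simp: hd_but dest: in_set_butlastD)
    with that show ?thesis by blast
  qed
  \<comment> \<open>By \<open>A\<close> and \<open>B\<close> only the last edges can meet outside \<open>x\<close>; if they do, \<open>es @ rev fs\<close> is a cycle.\<close>
  have "last es \<inter> last fs \<subseteq> {x}"
  proof (rule ccontr)
    assume "\<not> ?thesis"
    then obtain v where v: "v \<in> last es" "v \<in> last fs" "v \<noteq> x" by auto
    \<comment> \<open>Two single edges would share both \<open>x\<close> and \<open>v\<close>, which
      acyclicity forbids. Hence the list to be closed up has at least three edges, as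
      \<open>cycle_ofI\<close> needs.\<close>
    have len: "length es \<ge> 2 \<or> length fs \<ge> 2"
    proof (rule ccontr)
      assume "\<not> ?thesis"
      moreover have "length es \<noteq> 0" "length fs \<noteq> 0" using es0 by simp_all
      ultimately have "length es = 1" "length fs = 1" by linarith+
      then have mem: "last es = hd es" "last fs = hd fs" by (auto simp: length_Suc_conv)
      have "finite (hd es)" using c3[of "hd es"] es0 by (auto intro: card_ge_0_finite)
      moreover have "{x, v} \<subseteq> hd es \<inter> hd fs" using v mem x by auto
      ultimately have "card {x, v} \<le> card (hd es \<inter> hd fs)" by (intro card_mono) auto
      moreover have "card (hd es \<inter> hd fs) \<le> 1"
        using ac c3 es0 ne by (intro acyclic_edges_card_Int[of "set es \<union> set fs"]) auto
      ultimately show False using v by simp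
    qed
    \<comment> \<open>If the last edges coincided, the edge before \<open>last es\<close> would meet
      \<open>last fs\<close>, by \<open>A\<close> only in \<open>x\<close>; but then
      \<open>x\<close> would lie on a later edge of \<open>es\<close>. If \<open>es\<close> is a
      single edge, \<open>x\<close> would lie on a later edge of \<open>fs\<close> instead.\<close>
    have neq: "last es \<noteq> last fs"
    proof
      assume eq: "last es = last fs"
      show False
      proof (cases "butlast es = []")
        case True
        with es0 have "last es = hd es" by (cases es) (auto split: if_splits)
        then have "x \<in> last fs" using x eq by auto
        moreover have "last fs \<in> set (tl fs)"
          using len True es0 by (cases fs; cases es) (auto split: if_splits)
        ultimately show False using x by auto
      next
        case False
        let ?g = "last (butlast es)"
        have "linked (butlast es @ [last es])" using es es0 by (simp add: rooted_def)
        then have "card (?g \<inter> last es) = 1" using False by (auto simp: linked_append)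
        then obtain w where "w \<in> ?g \<inter> last es" by (metis card.empty ex_in_conv zero_neq_one)
        moreover have "?g \<inter> last fs \<subseteq> {x}" using False es0 by (intro A) auto
        ultimately have "x \<in> last es" using eq by auto
        moreover have "last es \<in> set (tl es)" using False by (cases es) auto
        ultimately show False using x by auto
      qed
    qed
    have fin: "finite (last es)"
      using c3[of "last es"] es0 by (auto intro: card_ge_0_finite)
    have "card (last es \<inter> last fs) \<le> 1"
      using ac c3 es0 neq by (intro acyclic_edges_card_Int[of "set es \<union> set fs"]) auto
    moreover have "card (last es \<inter> last fs) \<noteq> 0" using v fin by auto
    ultimately have one: "card (last es \<inter> last fs) = 1" by linarith
    have inter: "hd es \<inter> hd fs = {x}"
    proof (cases "length es \<ge> 2")
      case True
      then have "hd es \<in> set (butlast es)" by (cases es) auto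
      then have "hd es \<inter> hd fs \<subseteq> {x}" using es0 by (intro A) auto
      then show ?thesis using x by auto
    next
      case False
      then have "hd fs \<in> set (butlast fs)" using len by (cases fs) auto
      then have "hd es \<inter> hd fs \<subseteq> {x}" using es0 by (intro B) auto
      then show ?thesis using x by auto
    qed
    have le: "linked es" and lf: "linked fs" using es fs by (auto simp: rooted_def)
    have lt: "linked (tl gs)" if "linked gs" for gs :: "'a set list"
      using that by (cases gs) (auto simp: linked_Cons)
    have in1: "e \<in> set (butlast gs)" if "e \<in> set (butlast (tl gs))" for e and gs :: "'a set list"
      using that by (cases gs) (auto split: if_splits)
    \<comment> \<open>This list and the next are \<open>butlast\<close> and \<open>tl\<close> of
      \<open>es @ rev fs\<close>. Each omits one of the two first edges, so one side avoids
      \<open>x\<close> and the inclusions in \<open>{x}\<close> from \<open>A\<close> and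
      \<open>B\<close> become disjointness.\<close>
    have "linked (es @ rev (tl fs))"
      unfolding linked_append
    proof (intro conjI ballI impI)
      fix e f assume "e \<in> set (butlast es)" "f \<in> set (rev (tl fs))"
      then show "e \<inter> f = {}" using A[of e f] x(4)[of f] by (cases fs) auto
    next
      fix e f assume "e \<in> set es" "f \<in> set (tl (rev (tl fs)))"
      then have "e \<inter> f \<subseteq> {x}" "f \<in> set (tl fs)"
        using B[of e f] in1[of f fs] by (auto simp: tl_rev dest: in_set_butlastD)
      then show "e \<inter> f = {}" using x(4)[of f] by auto
    qed (use le lt[OF lf] one es0 in \<open>auto simp: hd_rev last_tl\<close>)
    moreover have "linked (tl es @ rev fs)"
      unfolding linked_append
    proof (intro conjI ballI impI)
      fix e f assume "e \<in> set (butlast (tl es))" "f \<in> set (rev fs)"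
      then show "e \<inter> f = {}" using A[of e f] in1[of e es] x(3)[of e] by (auto dest: in_set_butlastD)
    next
      fix e f assume e: "e \<in> set (tl es)" and "f \<in> set (tl (rev fs))"
      then have "e \<inter> f \<subseteq> {x}" using B[of e f] by (cases es) (auto simp: tl_rev)
      then show "e \<inter> f = {}" using x(3)[of e] e by auto
    qed (use lf lt[OF le] one es0 in \<open>auto simp: hd_rev last_tl\<close>)
    moreover have "butlast (es @ rev fs) = es @ rev (tl fs)" "tl (es @ rev fs) = tl es @ rev fs"
      using es0 by (auto simp: butlast_append butlast_rev)
    moreover have "butlast (tl es @ rev fs) = tl es @ rev (tl fs)"
      using es0 by (auto simp: butlast_append butlast_rev)
    moreover have "length (es @ rev fs) \<ge> 3" using len es0 by (cases es; cases fs) auto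
    moreover have "hd (es @ rev fs) = hd es" "last (es @ rev fs) = hd fs"
      using es0 by (auto simp: last_rev)
    ultimately have "cycle_of x (es @ rev fs) \<lparr>verts = \<Union> (set (es @ rev fs)), edges = set (es @ rev fs), marked = {}\<rparr>"
      using c3 x inter by (intro cycle_ofI) auto
    then show False using ac unfolding acyclic_edges_def by (metis set_append set_rev order_refl)
  qed
  moreover have "g = last gs \<or> g \<in> set (butlast gs)" if "g \<in> set gs" for g and gs :: "'a set list"
    using that by (cases gs rule: rev_cases) auto
  ultimately have "e \<inter> f \<subseteq> {x}" if "e \<in> set es" "f \<in> set fs" for e f
    using that A B by metis
  then have "\<Union> (set es) \<inter> \<Union> (set fs) \<subseteq> {x}" by blast
  moreover have "hd es \<in> set es" "hd fs \<in> set fs" using es0 by auto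
  ultimately show ?case using x(1,2) by blast
qed

section \<open>Joining and splitting paths at a vertex\<close>

text \<open>The shared vertex \<open>x\<close> lies only on the two first edges, so these form the
  junction and all other cross pairs are disjoint. Breaker's analysis uses this to merge two short
  nunchakus.\<close>

lemma edge_path_join:
  assumes "edge_path x a es" "edge_path x b fs" "\<Union> (set es) \<inter> \<Union> (set fs) = {x}"
  shows "edge_path a b (rev es @ fs)"
proof -
  have es: "rooted x es" "rooted a (rev es)" "x \<noteq> a" and fs: "rooted x fs" "rooted b (rev fs)" "x \<noteq> b"
    using assms by (auto simp: edge_path_def)
  have n: "es \<noteq> []" "fs \<noteq> []" and x: "x \<in> hd es" "x \<in> hd fs" "x \<notin> \<Union> (set (tl es))" "x \<notin> \<Union> (set (tl fs))"
    using es fs by (auto simp: rooted_def)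
  have ab: "a \<in> last es" "b \<in> last fs" using es fs by (auto simp: rooted_def hd_rev)
  have in_es: "last es \<in> set es" "last fs \<in> set fs" "hd es \<in> set es" "hd fs \<in> set fs" using n by auto
  have nab: "a \<notin> \<Union> (set fs)" "b \<notin> \<Union> (set es)" 
  proof -
    show "a \<notin> \<Union> (set fs)"
    proof
      assume "a \<in> \<Union> (set fs)"
      then have "a \<in> \<Union> (set es) \<inter> \<Union> (set fs)" using ab(1) in_es(1) by blast
      then show False using assms(3) es(3) by simp
    qed
    show "b \<notin> \<Union> (set es)"
    proof
      assume "b \<in> \<Union> (set es)"
      then have "b \<in> \<Union> (set es) \<inter> \<Union> (set fs)" using ab(2) in_es(2) by blast
      then show False using assms(3) fs(3) by simp
    qed
  qed
  have I: "e \<inter> f \<subseteq> {x}" if "e \<in> set es" "f \<in> set fs" for e f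
    using assms(3) that by blast
  have hh: "hd es \<inter> hd fs = {x}" using I[of "hd es" "hd fs"] in_es x(1,2) by auto
  have tls: "e \<in> set es" if "e \<in> set (tl es)" for e using that n by (cases es) auto
  have tls2: "e \<in> set fs" if "e \<in> set (tl fs)" for e using that n by (cases fs) auto
  have l: "linked (rev es @ fs)"
    unfolding linked_append
  proof (intro conjI ballI impI)
    fix e f assume "e \<in> set (butlast (rev es))" "f \<in> set fs"
    then have "e \<in> set (tl es)" "f \<in> set fs" by (auto simp: butlast_rev)
    then show "e \<inter> f = {}" using I[of e f] x(3) tls[of e] by auto
  next
    fix e f assume "e \<in> set (rev es)" "f \<in> set (tl fs)"
    then show "e \<inter> f = {}" using I[of e f] x(4) tls2[of f] by auto
  qed (use es fs hh n in \<open>auto simp: rooted_def last_rev\<close>)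
  have "rooted a (rev es @ fs)"
    using es(2) fs(1) l nab n by (auto simp: rooted_def)
  moreover have "rooted b (rev (rev es @ fs))"
  proof -
    have "linked (rev (rev es @ fs))" using l by (simp only: linked_rev)
    then show ?thesis using fs(2) es(1) nab n by (auto simp: rooted_def)
  qed
  moreover have "a \<noteq> b" using ab nab in_es by auto
  ultimately show ?thesis by (simp add: edge_path_def)
qed

text \<open>The vertex \<open>x\<close> is the single element of
  \<open>last es \<inter> hd fs\<close>. That \<open>a\<close> and \<open>b\<close> each avoid the
  other half is recorded because, once \<open>x\<close> is marked, each half must carry exactly two
  marks.\<close>

lemma edge_path_split:
  assumes "edge_path a b (es @ fs)" "es \<noteq> []" "fs \<noteq> []"
  obtains x where "edge_path a x es" "edge_path x b fs" "\<Union> (set es) \<inter> \<Union> (set fs) = {x}"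
    "a \<notin> \<Union> (set fs)" "b \<notin> \<Union> (set es)"
proof -
  have r: "rooted a (es @ fs)" "rooted b (rev fs @ rev es)" using assms(1) by (auto simp: edge_path_def)
  have l: "linked es" "linked fs" "card (last es \<inter> hd fs) = 1"
    and d: "\<And>e f. e \<in> set (butlast es) \<Longrightarrow> f \<in> set fs \<Longrightarrow> e \<inter> f = {}"
      "\<And>e f. e \<in> set es \<Longrightarrow> f \<in> set (tl fs) \<Longrightarrow> e \<inter> f = {}"
    using r(1) assms by (auto simp: rooted_def linked_append)
  obtain x where x: "last es \<inter> hd fs = {x}" using l(3) by (auto simp: card_1_singleton_iff)
  have mem: "last es \<in> set es" "hd fs \<in> set fs" using assms by auto
  have se: "e = last es \<or> e \<in> set (butlast es)" if "e \<in> set es" for e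
    using that by (cases es rule: rev_cases) auto
  have sf: "f = hd fs \<or> f \<in> set (tl fs)" if "f \<in> set fs" for f
    using that by (cases fs) auto
  have int: "\<Union> (set es) \<inter> \<Union> (set fs) = {x}"
  proof
    show "{x} \<subseteq> \<Union> (set es) \<inter> \<Union> (set fs)" using x mem by blast
    show "\<Union> (set es) \<inter> \<Union> (set fs) \<subseteq> {x}"
    proof safe
      fix v e f assume "v \<in> e" "e \<in> set es" "v \<in> f" "f \<in> set fs"
      then have "e = last es" "f = hd fs" using d se sf by blast+
      with \<open>v \<in> e\<close> \<open>v \<in> f\<close> x show "v = x" by blast
    qed
  qed
  have a: "a \<in> hd es" "a \<notin> \<Union> (set (tl es))" "a \<notin> \<Union> (set fs)" using r(1) assms by (auto simp: rooted_def)
  have b: "b \<in> last fs" "b \<notin> \<Union> (set (butlast fs))" "b \<notin> \<Union> (set es)"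
    using r(2) assms by (auto simp: rooted_def hd_rev tl_rev)
  have xe: "x \<notin> \<Union> (set (butlast es))" "x \<notin> \<Union> (set (tl fs))" using d mem x by blast+
  have c3: "\<And>e. e \<in> set es \<union> set fs \<Longrightarrow> card e = 3" using r(1) by (auto simp: rooted_def)
  have "x \<noteq> a" "x \<noteq> b" using a b int by blast+
  with a b xe x l c3 assms have "edge_path a x es" "edge_path x b fs"
    by (auto simp: edge_path_def rooted_def hd_rev tl_rev)
  with that int a b show thesis by blast
qed

section \<open>One round of the game\<close>

abbreviation after_round :: "'a mhypergraph \<Rightarrow> 'a \<Rightarrow> 'a \<Rightarrow> 'a mhypergraph" where
  "after_round H x y \<equiv> delete_vertex (mark_vertex H x) y"

lemma after_round_simps [simp]:
  "verts (after_round H x y) = verts H - {y}"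
  "edges (after_round H x y) = {e \<in> edges H. y \<notin> e}"
  "marked (after_round H x y) = insert x (marked H) - {y}"
  by (auto simp: delete_vertex_def mark_vertex_def)

lemma marked_hypergraph_round:
  assumes "marked_hypergraph H" "x \<in> unmarked H" "y \<in> unmarked H - {x}"
  shows "marked_hypergraph (after_round H x y)"
  using assms by (auto simp: marked_hypergraph_def unmarked_def)

lemma finite_unmarked: "marked_hypergraph H \<Longrightarrow> finite (unmarked H)"
  by (auto simp: marked_hypergraph_def unmarked_def)

lemma unmarked_minus_nonempty:
  assumes "\<not> card (unmarked H) \<le> 1"
  shows "unmarked H - {x} \<noteq> {}"
proof
  assume "unmarked H - {x} = {}"
  then have "card (unmarked H) \<le> card {x}" by (intro card_mono) auto
  then show False using assms by simp
qed

text \<open>Translates the min-max recursion into a move of Maker and all replies of Breaker. The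
  sets involved are finite and nonempty, so minimum and maximum are attained.\<close>

lemma tau_M_round_le_iff:
  assumes "marked_hypergraph H" "\<not> trivial_maker_win H" "\<not> card (unmarked H) \<le> 1"
  shows "tau_M H \<le> 1 + n \<longleftrightarrow> (\<exists>x\<in>unmarked H. \<forall>y\<in>unmarked H - {x}. tau_M (after_round H x y) \<le> n)"
proof -
  have fin: "finite (unmarked H)" by (rule finite_unmarked[OF assms(1)])
  have "tau_M H = 1 + (MIN x\<in>unmarked H. MAX y\<in>unmarked H - {x}. tau_M (after_round H x y))"
    using assms by (subst tau_M.simps) simp
  moreover have "1 + m \<le> 1 + n \<longleftrightarrow> m \<le> n" for m :: enat
    by (simp add: enat_add_left_cancel_le)
  moreover have "unmarked H \<noteq> {}" using assms(3) by auto
  ultimately show ?thesis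
    using fin unmarked_minus_nonempty[OF assms(3)] by (simp add: Min_le_iff)
qed

lemma tau_M_trivial_le:
  assumes "marked_hypergraph H" "e \<in> edges H"  "card (e - marked H) \<le> 1"
  shows "tau_M H \<le> 1"
proof -
  have "trivial_maker_win H" using assms by (auto simp: trivial_maker_win_def)
  moreover have "finite (edges H)"
    using assms(1) by (intro finite_subset[of "edges H" "Pow (verts H)"]) (auto simp: marked_hypergraph_def)
  then have "(MIN e\<in>edges H. card (e - marked H)) \<le> card (e - marked H)"
    using assms by (intro Min_le) auto
  ultimately show ?thesis
    using assms by (subst tau_M.simps) (simp add: one_enat_def)
qed

text \<open>The recursion of \<open>maker_win\<close> looks for a trivial win only when at most one
  unmarked vertex is left, so the win has to be carried to the end of play. Maker completes the edge
  \<open>e\<close>, and Breaker can no longer delete any of its vertices.\<close>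

lemma maker_win_trivial:
  assumes "marked_hypergraph H" "trivial_maker_win H"
  shows "maker_win H"
  using assms
proof (induction H rule: maker_win.induct)
  case (1 H)
  show ?case
  proof (cases "card (unmarked H) \<le> 1")
    case True
    then show ?thesis using 1 by (simp add: maker_win.simps)
  next
    case False
    obtain e where e: "e \<in> edges H" "card (e - marked H) \<le> 1"
      using 1 by (auto simp: trivial_maker_win_def)
    have sub: "e \<subseteq> verts H" "finite (verts H)"
      using e "1.prems" by (auto simp: marked_hypergraph_def)
    then have "finite e" by (rule finite_subset)
    \<comment> \<open>This is the one missing vertex of \<open>e\<close>, or an arbitrary unmarked
      vertex if \<open>e\<close> is already fully marked.\<close>
    have "\<exists>x\<in>unmarked H. e - marked H \<subseteq> {x}"
    proof (cases "e - marked H = {}")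
      case True
      then show ?thesis using False by (cases "unmarked H = {}") auto
    next
      case ne: False
      then obtain x where x: "x \<in> e - marked H" by auto
      then have "{x} = e - marked H" using e \<open>finite e\<close> by (intro card_seteq) auto
      then show ?thesis using x sub by (auto simp: unmarked_def)
    qed
    then obtain x where x: "x \<in> unmarked H" "e - marked H \<subseteq> {x}" by blast
    have "maker_win (after_round H x y)" if y: "y \<in> unmarked H - {x}" for y
    proof (rule "1.IH"[OF False x(1) y])
      show "marked_hypergraph (after_round H x y)"
        by (rule marked_hypergraph_round[OF "1.prems"(1) x(1) y])
      have "y \<notin> e" using x y by (auto simp: unmarked_def)
      moreover have "e - (insert x (marked H) - {y}) = {}" using x(2) \<open>y \<notin> e\<close> by auto
      ultimately show "trivial_maker_win (after_round H x y)"
        using e unfolding trivial_maker_win_def after_round_simps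
        by (intro bexI[of _ e]) (simp_all only: card.empty zero_le mem_Collect_eq simp_thms)
    qed
    then show ?thesis using False x by (subst maker_win.simps) auto
  qed
qed

text \<open>Breaker has finitely many replies to a winning move, so the maximum of the finite values
  after them is finite.\<close>

lemma maker_win_imp_tau_M_finite:
  assumes "marked_hypergraph H" "maker_win H"
  shows "tau_M H \<noteq> \<infinity>"
  using assms
proof (induction H rule: maker_win.induct)
  case (1 H)
  show ?case
  proof (cases "trivial_maker_win H")
    case True
    then show ?thesis by (subst tau_M.simps) simp
  next
    case nt: False
    then have False: "\<not> card (unmarked H) \<le> 1" using "1.prems" by (auto simp: maker_win.simps)
    then obtain x where x: "x \<in> unmarked H" "\<forall>y\<in>unmarked H - {x}. maker_win (after_round H x y)"
      using "1.prems" by (subst (asm) maker_win.simps) auto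
    have fin: "finite (unmarked H)" using "1.prems" finite_unmarked by blast
    have *: "tau_M (after_round H x y) \<noteq> \<infinity>" if "y \<in> unmarked H - {x}" for y
      using "1.IH"[OF False x(1) that] marked_hypergraph_round[OF "1.prems"(1) x(1) that] x(2) that
      by blast
    define n where "n = (MAX y\<in>unmarked H - {x}. tau_M (after_round H x y))"
    have "n \<in> (\<lambda>y. tau_M (after_round H x y)) ` (unmarked H - {x})"
      unfolding n_def using fin unmarked_minus_nonempty[OF False, of x] by (intro Max_in) auto
    then have "n \<noteq> \<infinity>" using * by auto
    have "\<forall>y\<in>unmarked H - {x}. tau_M (after_round H x y) \<le> n"
      unfolding n_def using fin by auto
    then have "tau_M H \<le> 1 + n"
      using tau_M_round_le_iff[OF _ nt False] "1.prems" x by blast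
    then show ?thesis using \<open>n \<noteq> \<infinity>\<close> by (cases n; cases "tau_M H") (auto simp: one_enat_def)
  qed
qed

section \<open>Maker's strategy and the upper bound\<close>

lemma edge_path_singleton_card:
  assumes "edge_path a b [e]" "e \<inter> M = {a, b}"
  shows "card (e - M) \<le> 1"
proof -
  have "card e = 3" "a \<noteq> b" using assms by (auto simp: edge_path_def rooted_def)
  moreover from this have "finite e" by (auto intro: card_ge_0_finite)
  ultimately show ?thesis using assms(2) by (simp add: card_Diff_subset_Int)
qed

text \<open>Here \<open>k\<close> counts the halvings: after \<open>k\<close> of them a single edge
  with two marked vertices is left, and one more mark completes it.\<close>

lemma nunchaku_imp_maker_win:
  assumes "marked_hypergraph H" "nunchaku_in H a b es" "length es \<le> 2 ^ k"
  shows "maker_win H \<and> tau_M H \<le> 1 + enat k"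
  using assms
proof (induction k arbitrary: H a b es)
  case (0 H a b es)
  moreover have "es \<noteq> []" using 0 by (auto simp: nunchaku_in_def edge_path_def rooted_def)
  ultimately obtain e where es: "es = [e]" by (cases es) auto
  then have "e \<in> edges H" "card (e - marked H) \<le> 1"
    using 0 edge_path_singleton_card[of a b e "marked H"] by (auto simp: nunchaku_in_def)
  then have "trivial_maker_win H" "tau_M H \<le> 1"
    using "0.prems"(1) tau_M_trivial_le[of H e] by (auto simp: trivial_maker_win_def)
  then show ?case
    using maker_win_trivial "0.prems"(1) by (simp add: zero_enat_def[symmetric])
next
  case (Suc k H a b es)
  show ?case
  proof (cases "trivial_maker_win H")
    case True
    then have "tau_M H \<le> 1" using Suc.prems tau_M_trivial_le by (auto simp: trivial_maker_win_def)
    also have "(1::enat) \<le> 1 + enat (Suc k)" by simp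
    finally show ?thesis using True maker_win_trivial Suc.prems by blast
  next
    case nt: False
    have path: "edge_path a b es" and sub: "set es \<subseteq> edges H" and m: "\<Union> (set es) \<inter> marked H = {a, b}"
      using Suc.prems by (auto simp: nunchaku_in_def)
    have ne: "es \<noteq> []" using path by (auto simp: edge_path_def rooted_def)
    have len: "length es \<ge> 2"
    proof (rule ccontr)
      assume "\<not> ?thesis"
      with ne obtain e where es: "es = [e]" by (cases es) (auto simp: not_le less_Suc_eq_le)
      then have "e \<in> edges H" "card (e - marked H) \<le> 1"
        using path sub m edge_path_singleton_card[of a b e "marked H"] by auto
      then show False using nt by (auto simp: trivial_maker_win_def)
    qed
    \<comment> \<open>The longer half has half of \<open>length es\<close>, rounded up, which is
      still at most \<open>2 ^ k\<close> because \<open>length es \<le> 2 ^ Suc k\<close>.\<close>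
    define xs ys where "xs = take (length es div 2) es" and "ys = drop (length es div 2) es"
    have xy: "es = xs @ ys" "xs \<noteq> []" "ys \<noteq> []" "length xs \<le> 2 ^ k" "length ys \<le> 2 ^ k"
      using len Suc.prems(3) by (auto simp: xs_def ys_def)
    obtain x where x: "edge_path a x xs" "edge_path x b ys" "\<Union> (set xs) \<inter> \<Union> (set ys) = {x}"
      "a \<notin> \<Union> (set ys)" "b \<notin> \<Union> (set xs)"
      using edge_path_split[of a b xs ys] path xy by metis
    have xab: "x \<noteq> a" "x \<noteq> b" using x by (auto simp: edge_path_def)
    have xu: "x \<in> \<Union> (set es)" using x(3) xy(1) by auto
    have vs: "\<Union> (set es) \<subseteq> verts H" using sub Suc.prems by (auto simp: marked_hypergraph_def)
    have xun: "x \<in> unmarked H" using vs xu m xab by (auto simp: unmarked_def)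
    have split: "\<Union> (set es) = \<Union> (set xs) \<union> \<Union> (set ys)" using xy(1) by simp
    have ms: "\<Union> (set xs) \<inter> marked H = {a}" "\<Union> (set ys) \<inter> marked H = {b}"
    proof -
      have *: "(v \<in> \<Union> (set es) \<inter> marked H) = (v \<in> {a, b})" for v by (simp only: m)
      have "a \<in> marked H" "b \<in> marked H" "a \<in> \<Union> (set xs)" "b \<in> \<Union> (set ys)"
        using *[of a] *[of b] x(4,5) unfolding split by blast+
      moreover have "v = a \<or> v = b" if "v \<in> \<Union> (set xs) \<union> \<Union> (set ys)" "v \<in> marked H" for v
        using *[of v] that unfolding split by blast
      ultimately show "\<Union> (set xs) \<inter> marked H = {a}" "\<Union> (set ys) \<inter> marked H = {b}"
        using x(4,5) by blast+
    qed
    have xx: "x \<in> \<Union> (set xs)" "x \<in> \<Union> (set ys)" using x(3) by blast+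
    have win: "maker_win (after_round H x y) \<and> tau_M (after_round H x y) \<le> 1 + enat k"
      if y: "y \<in> unmarked H - {x}" for y
    proof -
      have mh: "marked_hypergraph (after_round H x y)"
        using Suc.prems xun y by (intro marked_hypergraph_round)
      show ?thesis
      \<comment> \<open>The halves share only \<open>x\<close>, and \<open>y \<noteq> x\<close>, so
        at least one half survives the deletion intact.\<close>
      proof (cases "y \<in> \<Union> (set xs)")
        case False
        have "\<Union> (set xs) \<inter> marked (after_round H x y) = {a, x}"
          using ms(1) xx(1) False unfolding after_round_simps by blast
        moreover have "set xs \<subseteq> edges (after_round H x y)" using sub False xy(1) by auto
        ultimately have "nunchaku_in (after_round H x y) a x xs"
          using x(1) by (simp add: nunchaku_in_def)
        then show ?thesis using Suc.IH[OF mh] xy by blast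
      next
        case True
        then have ny: "y \<notin> \<Union> (set ys)" using x(3) y by (metis DiffD2 IntI)
        have "\<Union> (set ys) \<inter> marked (after_round H x y) = {x, b}"
          using ms(2) xx(2) ny unfolding after_round_simps by blast
        moreover have "set ys \<subseteq> edges (after_round H x y)" using sub ny xy(1) by auto
        ultimately have "nunchaku_in (after_round H x y) x b ys"
          using x(2) by (simp add: nunchaku_in_def)
        then show ?thesis using Suc.IH[OF mh] xy by blast
      qed
    qed
    \<comment> \<open>Needed to enter the recursive clause: if \<open>x\<close> were the only
      unmarked vertex, the edge \<open>hd xs\<close> would already be a trivial win.\<close>
    have c: "\<not> card (unmarked H) \<le> 1"
    proof
      assume "card (unmarked H) \<le> 1"
      then have *: "unmarked H \<subseteq> {x}"
        using xun finite_unmarked[OF Suc.prems(1)] by (metis card_le_Suc0_iff_eq One_nat_def singletonI subsetI)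
      have "hd xs \<in> set xs" "card (hd xs) = 3" using x(1) by (auto simp: edge_path_def rooted_def)
      have "hd xs \<in> edges H" using \<open>hd xs \<in> set xs\<close> sub xy(1) by auto
      have "hd xs - marked H \<subseteq> {x}"
        using * vs \<open>hd xs \<in> set xs\<close> xy(1) by (auto simp: unmarked_def)
      then have "card (hd xs - marked H) \<le> card {x}" by (intro card_mono) auto
      then show False using nt \<open>hd xs \<in> edges H\<close> by (auto simp: trivial_maker_win_def)
    qed
    have "maker_win H" using c xun win by (subst maker_win.simps) auto
    moreover have "tau_M H \<le> 1 + (1 + enat k)"
      using tau_M_round_le_iff[OF Suc.prems(1) nt c] xun win by blast
    moreover have "1 + (1 + enat k) = 1 + enat (Suc k)" by (simp add: one_enat_def)
    ultimately show ?thesis by simp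
  qed
qed

section \<open>Breaker's strategy and the lower bound\<close>

text \<open>The invariant of the lower bound, with cycle-freeness stated for the edge set alone so
  that it passes to the position after a round.\<close>

definition breaker_safe :: "'a mhypergraph \<Rightarrow> bool" where
  "breaker_safe H \<longleftrightarrow> marked_hypergraph H \<and> three_uniform H \<and> acyclic_edges (edges H) \<and>
     \<not> (\<exists>e\<in>edges H. e \<subseteq> marked H)"

text \<open>A nunchaku counts as short when twice its length is at most \<open>N\<close>, so that
  two short ones joined at \<open>x\<close> would have had length at most \<open>N\<close> before
  the move.\<close>

lemma breaker_answer:
  assumes H: "breaker_safe H" and x: "x \<in> unmarked H" and c: "\<not> card (unmarked H) \<le> 1"
    and nun: "\<And>a b es. nunchaku_in H a b es \<Longrightarrow> length es > N"
    and nt: "\<not> trivial_maker_win H"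
  shows "\<exists>y\<in>unmarked H - {x}. \<forall>a b es. nunchaku_in (after_round H x y) a b es \<longrightarrow> 2 * length es > N"
proof -
  have mh: "marked_hypergraph H" and ac: "acyclic_edges (edges H)"
    using H by (auto simp: breaker_safe_def)
  \<comment> \<open>A short nunchaku that appears when \<open>x\<close> is marked has \<open>x\<close> as an endpoint.\<close>
  have start: "\<exists>b es. edge_path x b es \<and> set es \<subseteq> edges H \<and> y \<notin> \<Union> (set es) \<and>
      \<Union> (set es) \<inter> insert x (marked H) = {x, b} \<and> 2 * length es \<le> N"
    if "nunchaku_in (after_round H x y) a b es" "2 * length es \<le> N" "y \<in> unmarked H - {x}" for a b es y
  proof -
    have p: "edge_path a b es" "set es \<subseteq> edges H" "y \<notin> \<Union> (set es)"
      and m: "\<Union> (set es) \<inter> insert x (marked H) = {a, b}"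
      using that by (auto simp: nunchaku_in_def)
    have "x \<in> \<Union> (set es)"
    proof (rule ccontr)
      assume "x \<notin> \<Union> (set es)"
      then have "nunchaku_in H a b es" using p m by (simp add: nunchaku_in_def)
      then show False using nun[of a b es] that(2) by simp
    qed
    then have "x = a \<or> x = b" using m by auto
    then show ?thesis
    proof
      assume "x = a"
      with p m that(2) show ?thesis by (intro exI[of _ b] exI[of _ es]) simp
    next
      assume "x = b"
      moreover have "edge_path b a (rev es)" using p(1) by (rule edge_path_rev)
      ultimately show ?thesis using p m that(2)
        by (intro exI[of _ a] exI[of _ "rev es"]) (simp add: insert_commute)
    qed
  qed
  \<comment> \<open>The short nunchakus from \<open>x\<close> once \<open>x\<close> is marked but
    before any deletion: Breaker's vertex is chosen by looking at these.\<close>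
  let ?P = "\<lambda>b es. edge_path x b es \<and> set es \<subseteq> edges H \<and>
      \<Union> (set es) \<inter> insert x (marked H) = {x, b} \<and> 2 * length es \<le> N"
  show ?thesis
  proof (cases "\<exists>b es. ?P b es")
    case False
    obtain y where y: "y \<in> unmarked H - {x}" using unmarked_minus_nonempty[OF c] by blast
    have "2 * length es > N" if "nunchaku_in (after_round H x y) a b es" for a b es
      using start[OF that _ y] False by (metis not_le)
    with y show ?thesis by blast
  next
    case True
    then obtain b es where es: "?P b es" by blast
    let ?e = "hd es"
    have same: "hd fs = ?e" if fs: "?P d fs" for d fs
    proof (rule ccontr)
      assume ne: "hd fs \<noteq> ?e"
      have "\<Union> (set fs) \<inter> \<Union> (set es) = {x}"
        using fs es ne acyclic_edges_mono[OF ac, of "set fs \<union> set es"]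
        by (intro rooted_diverge) (auto simp: edge_path_def)
      then have "edge_path d b (rev fs @ es)" using fs es by (intro edge_path_join) auto
      moreover have "\<Union> (set (rev fs @ es)) \<inter> marked H = {d, b}"
      proof -
        \<comment> \<open>Before the move \<open>x\<close> carries no mark, so each branch
          contributes only its far end to the marks of the joined path.\<close>
        have "x \<notin> marked H" using x by (simp add: unmarked_def)
        then have *: "A \<inter> marked H = A \<inter> insert x (marked H) - {x}" for A by blast
        have "x \<noteq> d" "x \<noteq> b" using fs es by (auto simp: edge_path_def)
        then have "\<Union> (set fs) \<inter> marked H = {d}" "\<Union> (set es) \<inter> marked H = {b}"
          unfolding *[of "\<Union> (set _)"] using fs es by auto
        then show ?thesis by (simp add: Int_Un_distrib2 insert_commute)
      qed
      ultimately have "nunchaku_in H d b (rev fs @ es)"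
        using fs es by (auto simp: nunchaku_in_def)
      then show False using nun[of d b "rev fs @ es"] fs es by simp
    qed
    have e: "?e \<in> set es" "x \<in> ?e" using es by (auto simp: edge_path_def rooted_def)
    then have eH: "?e \<in> edges H" using es by auto
    have ev: "?e \<subseteq> verts H" using eH mh by (auto simp: marked_hypergraph_def)
    \<comment> \<open>Without a trivial win, the common first edge has at least two unmarked
      vertices, so one other than \<open>x\<close> is available for deletion.\<close>
    have "\<not> card (?e - marked H) \<le> 1" using nt eH by (auto simp: trivial_maker_win_def)
    then have "\<not> ?e - marked H \<subseteq> {x}"
      using card_mono[of "{x}" "?e - marked H"] by auto
    then obtain y where y: "y \<in> ?e" "y \<notin> marked H" "y \<noteq> x" by auto
    then have yu: "y \<in> unmarked H - {x}" using ev by (auto simp: unmarked_def)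
    have "2 * length gs > N" if g: "nunchaku_in (after_round H x y) a' b' gs" for a' b' gs
    proof (rule ccontr)
      assume "\<not> ?thesis"
      then obtain d fs where fs: "?P d fs" "y \<notin> \<Union> (set fs)"
        using start[OF g _ yu] by (metis not_less)
      then have "fs \<noteq> []" by (auto simp: edge_path_def rooted_def)
      then show False using same[OF fs(1)] fs(2) y(1) by (metis UnionI hd_in_set)
    qed
    with yu show ?thesis by blast
  qed
qed

text \<open>As no edge is fully marked, a trivial win comes from an edge with exactly two marked
  vertices, and this is a nunchaku of length 1.\<close>

lemma trivial_imp_nunchaku:
  assumes "breaker_safe H" "trivial_maker_win H"
  shows "\<exists>a b e. nunchaku_in H a b [e]"
proof -
  obtain e where e: "e \<in> edges H" "card (e - marked H) \<le> 1"
    using assms by (auto simp: trivial_maker_win_def)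
  have c: "card e = 3" and ne: "\<not> e \<subseteq> marked H" using assms e by (auto simp: breaker_safe_def three_uniform_def)
  have fin: "finite e" using c by (auto intro: card_ge_0_finite)
  then have "card (e - marked H) \<noteq> 0" using ne by auto
  then have "card (e - marked H) = 1" using e by linarith
  then have "card (e \<inter> marked H) = 2"
    using c card_Diff_subset_Int[of e "marked H"] fin card_mono[of e "e \<inter> marked H"] by auto
  then obtain a b where ab: "e \<inter> marked H = {a, b}" "a \<noteq> b" by (auto simp: card_2_iff)
  then have "nunchaku_in H a b [e]"
    using e c by (auto simp: nunchaku_in_def edge_path_def rooted_def)
  then show ?thesis by blast
qed

text \<open>The value 0 would require a fully marked edge.\<close>

lemma tau_M_ge_1: assumes "breaker_safe H" shows "1 \<le> tau_M H"
proof (cases "trivial_maker_win H")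
  case True
  have fe: "finite e" if "e \<in> edges H" for e
    using assms that by (auto simp: breaker_safe_def three_uniform_def intro: card_ge_0_finite)
  have "edges H \<noteq> {}" using True by (auto simp: trivial_maker_win_def)
  moreover have "finite (edges H)"
    using assms by (intro finite_subset[of "edges H" "Pow (verts H)"]) (auto simp: breaker_safe_def marked_hypergraph_def)
  moreover have "1 \<le> card (e - marked H)" if "e \<in> edges H" for e
    using assms that fe[OF that] by (auto simp: breaker_safe_def Suc_le_eq card_gt_0_iff)
  ultimately have "1 \<le> (MIN e\<in>edges H. card (e - marked H))" by (intro Min.boundedI) auto
  then show ?thesis using True by (subst tau_M.simps) (simp add: one_enat_def)
next
  case False
  then show ?thesis by (subst tau_M.simps) simp
qed

text \<open>An edge that becomes fully marked when \<open>x\<close> is marked had at most one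
  unmarked vertex before, so the position would already have been a trivial win.\<close>

lemma breaker_safe_round:
  assumes H: "breaker_safe H" and nt: "\<not> trivial_maker_win H" and xy: "x \<in> unmarked H" "y \<in> unmarked H - {x}"
  shows "breaker_safe (after_round H x y)"
proof -
  have "acyclic_edges (edges (after_round H x y))"
    using H by (auto simp: breaker_safe_def elim!: acyclic_edges_mono)
  moreover have "\<not> e \<subseteq> marked (after_round H x y)" if "e \<in> edges (after_round H x y)" for e
  proof
    assume "e \<subseteq> marked (after_round H x y)"
    then have "card (e - marked H) \<le> card {x}" by (intro card_mono) auto
    then show False using nt that by (auto simp: trivial_maker_win_def)
  qed
  ultimately show ?thesis
    using H xy marked_hypergraph_round[of H x y] by (auto simp: breaker_safe_def three_uniform_def)
qed

text \<open>The doubled form expresses a length above \<open>2 ^ (k - 1)\<close> without a special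
  case at \<open>k = 0\<close>. When there is no nunchaku the condition holds vacuously for every
  \<open>k\<close>.\<close>

lemma tau_M_lower_bound:
  assumes "breaker_safe H" "\<And>a b es. nunchaku_in H a b es \<Longrightarrow> 2 * length es > 2 ^ k"
  shows "1 + enat k \<le> tau_M H"
  using assms
proof (induction k arbitrary: H)
  case 0
  then show ?case using tau_M_ge_1 by (simp add: zero_enat_def[symmetric])
next
  case (Suc k)
  have nun: "length es > 2 ^ k" if "nunchaku_in H a b es" for a b es using Suc.prems(2)[OF that] by simp
  \<comment> \<open>A trivial win would give a nunchaku of length 1, while all lengths exceed
    \<open>2 ^ k \<ge> 1\<close>.\<close>
  have nt: "\<not> trivial_maker_win H"
  proof
    assume "trivial_maker_win H"
    then obtain a b e where "nunchaku_in H a b [e]" using trivial_imp_nunchaku Suc.prems by blast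
    then show False using nun[of a b "[e]"] by simp
  qed
  show ?case
  proof (cases "card (unmarked H) \<le> 1")
    case True
    then show ?thesis using nt by (subst tau_M.simps) simp
  next
    case c: False
    have mh: "marked_hypergraph H" using Suc.prems by (simp add: breaker_safe_def)
    show ?thesis
    proof (rule ccontr)
      assume "\<not> ?thesis"
      then have "tau_M H < 1 + enat (Suc k)" by simp
      then have "tau_M H \<le> 1 + enat k"
        by (cases "tau_M H") (auto simp: one_enat_def)
      then obtain x where x: "x \<in> unmarked H" "\<And>y. y \<in> unmarked H - {x} \<Longrightarrow> tau_M (after_round H x y) \<le> enat k"
        using tau_M_round_le_iff[OF mh nt c] by blast
      obtain y where y: "y \<in> unmarked H - {x}"
        "\<And>a b es. nunchaku_in (after_round H x y) a b es \<Longrightarrow> 2 * length es > 2 ^ k"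
        using breaker_answer[OF Suc.prems(1) x(1) c _ nt, of "2 ^ k"] nun by blast
      have "1 + enat k \<le> tau_M (after_round H x y)"
        using Suc.IH breaker_safe_round[OF Suc.prems(1) nt x(1) y(1)] y(2) by blast
      also have "\<dots> \<le> enat k" using x y by blast
      finally show False by (simp add: one_enat_def)
    qed
  qed
qed

section \<open>Combining the two bounds\<close>

theorem mainTheorem7:
  fixes H :: "'a mhypergraph"
  assumes "hyperforest3 H"
    and "\<not> (\<exists>e\<in>edges H. e \<subseteq> marked H)"
  shows "(maker_win H \<longleftrightarrow> contains_nunchaku H) \<and>
    (maker_win H \<longrightarrow>
      tau_M H = 1 + enat (nat \<lceil>log 2 (real (shortest_nunchaku_length H))\<rceil>))"
proof -
  have mh: "marked_hypergraph H" using assms(1) by (simp add: hyperforest3_def)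
  have safe: "breaker_safe H"
    using assms hyperforest3_acyclic_edges[OF assms(1)] by (simp add: breaker_safe_def hyperforest3_def)
  let ?N = "\<lambda>L. \<exists>X. subhypergraph X H \<and> is_nunchaku X L"
  note iff = ex_nunchaku_iff[OF mh]
  have con: "contains_nunchaku H \<longleftrightarrow> (\<exists>L. ?N L)" by (auto simp: contains_nunchaku_def)
  have nwin: "contains_nunchaku H" if win: "maker_win H"
  proof (rule ccontr)
    assume "\<not> contains_nunchaku H"
    then have none: "\<not> nunchaku_in H a b es" for a b es using con iff by blast
    \<comment> \<open>With no nunchaku present the lower bound holds for every \<open>k\<close>,
      which contradicts the finite value of a Maker win.\<close>
    have "1 + enat k \<le> tau_M H" for k using tau_M_lower_bound[OF safe] none by blast
    moreover obtain t where "tau_M H = enat t" using maker_win_imp_tau_M_finite[OF mh win] by auto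
    ultimately have "1 + enat t \<le> enat t" by metis
    then show False by (simp add: one_enat_def)
  qed
  have main: "maker_win H \<and> tau_M H = 1 + enat (nat \<lceil>log 2 (real (shortest_nunchaku_length H))\<rceil>)"
    if "contains_nunchaku H"
  proof -
    define L where "L = shortest_nunchaku_length H"
    have "?N L" unfolding L_def shortest_nunchaku_length_def
      by (rule LeastI_ex[of ?N]) (use that con in blast)
    then obtain a b es where es: "nunchaku_in H a b es" "length es = L" using iff by blast
    have least: "L \<le> length fs" if "nunchaku_in H c d fs" for c d fs
      unfolding L_def shortest_nunchaku_length_def using that iff by (intro Least_le) blast
    have "es \<noteq> []" using es by (auto simp: nunchaku_in_def edge_path_def rooted_def)
    then have L1: "L \<ge> 1" using es by (cases es) auto
    \<comment> \<open>Since \<open>L \<ge> 1\<close> the logarithm is nonnegative and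
      \<open>nat\<close> loses nothing. The facts \<open>up\<close> and \<open>low\<close> below
      bracket \<open>L\<close> between consecutive powers of 2, exactly as the upper and the lower
      bound require.\<close>
    define k where "k = nat \<lceil>log 2 (real L)\<rceil>"
    have log0: "log 2 (real L) \<ge> 0" using L1 by simp
    have "log 2 (real L) \<le> real k" unfolding k_def using log0 by linarith
    then have "real L \<le> 2 powr real k" using L1 by (simp add: log_le_iff)
    then have "real L \<le> real (2 ^ k)" by (simp add: powr_realpow)
    then have up: "L \<le> 2 ^ k" by (simp only: of_nat_le_iff)
    have low: "2 ^ k < 2 * L"
    proof -
      have "real k < log 2 (real L) + 1" unfolding k_def using log0 by linarith
      also have "\<dots> = log 2 (2 * real L)" using L1 by (simp add: log_mult)
      finally have "2 powr real k < 2 * real L" using L1 by (simp add: less_log_iff)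
      then have "real (2 ^ k) < real (2 * L)" by (simp add: powr_realpow)
      then show ?thesis by (simp only: of_nat_less_iff)
    qed
    have "maker_win H" "tau_M H \<le> 1 + enat k"
      using nunchaku_imp_maker_win[OF mh es(1), of k] up es(2) by auto
    moreover have "1 + enat k \<le> tau_M H"
      using least low by (intro tau_M_lower_bound[OF safe]) (meson less_le_trans mult_le_mono2)
    ultimately show ?thesis unfolding k_def L_def by auto
  qed
  show ?thesis using nwin main by blast
qed

end
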